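(* Let $a,b>0$, let $\alpha,\beta,m$ be real numbers, and let $n\ge 1$ be the dimension. (i) If $\alpha\beta>0$ and $m\le\frac{n-2}{2}$, then for all $u\in C_0^\infty(\mathbb{R}^n)$ $$\int_{\mathbb{R}^n}\frac{(a+b|x|^\alpha)^\beta}{|x|^{2m}}|\nabla u|^2dx\ge\Big(\frac{n-2m-2}{2}\Big)^2\int_{\mathbb{R}^n}\frac{(a+b|x|^\alpha)^\beta}{|x|^{2m+2}}u^2dx,$$ and $\big(\frac{n-2m-2}{2}\big)^2$ is the best constant in the inequality. (ii) If $\alpha\beta<0$ and $2m-\alpha\beta\le n-2$, then for all $u\in C_0^\infty(\mathbb{R}^n)$ $$\int_{\mathbb{R}^n}\frac{(a+b|x|^\alpha)^\beta}{|x|^{2m}}|\nabla u|^2dx\ge\Big(\frac{n-2m+\alpha\beta-2}{2}\Big)^2\int_{\mathbb{R}^n}\frac{(a+b|x|^\alpha)^\beta}{|x|^{2m+2}}u^2dx,$$ and $\big(\frac{n-2m+\alpha\beta-2}{2}\big)^2$ is the best constant in the inequality.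
   Context: A constant in such an inequality is best if the inequality for all $u\in C_0^\infty(\mathbb{R}^n)$ fails when it is replaced by any larger constant. *)

theory Defs
  imports "HOL-Analysis.Analysis"
begin

primrec C_k :: "nat \<Rightarrow> (real ^ 'n \<Rightarrow> real) \<Rightarrow> bool" where
  "C_k 0 u \<longleftrightarrow> continuous_on UNIV u"
| "C_k (Suc k) u \<longleftrightarrow>
     (\<forall>x. u differentiable (at x)) \<and>
     (\<forall>v. C_k k (\<lambda>x. frechet_derivative u (at x) v))"

definition C0_infinity :: "(real ^ 'n \<Rightarrow> real) set" where
  "C0_infinity = {u. (\<forall>k. C_k k u) \<and> compact (closure {x. u x \<noteq> 0})}"

definition grad :: "(real ^ 'n \<Rightarrow> real) \<Rightarrow> real ^ 'n \<Rightarrow> real ^ 'n" where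
  "grad u x = (THE D. GDERIV u x :> D)"

lemma GDERIV_grad:
  fixes u :: "real ^ 'n \<Rightarrow> real"
  assumes "u differentiable (at x)"
  shows "GDERIV u x :> grad u x"
proof -
  obtain f where f: "(u has_derivative f) (at x)"
    using assms by (auto simp: differentiable_def)
  then have lin: "linear f"
    by (rule has_derivative_linear)
  have eq: "f = (\<lambda>h. inner h (adjoint f 1))"
    using adjoint_works[OF lin, of _ 1] by (intro ext) simp
  have D: "GDERIV u x :> adjoint f 1"
    unfolding gderiv_def using f by (subst (asm) eq)
  show ?thesis
    unfolding grad_def
  proof (rule theI)
    show "GDERIV u x :> adjoint f 1"
      by (rule D)
  next
    fix D'
    assume "GDERIV u x :> D'"
    then have "(\<lambda>h. inner h D') = (\<lambda>h. inner h (adjoint f 1))"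
      using D unfolding gderiv_def by (rule has_derivative_unique)
    then have "\<forall>h. inner h D' = inner h (adjoint f 1)"
      by (simp add: fun_eq_iff)
    then show "D' = adjoint f 1"
      by (simp only: vector_eq_ldot vector_eq_rdot)
  qed
qed

text \<open>
  The values at the origin follow the conventions \<open>0 powr s = 0\<close> and \<open>y / 0 = 0\<close>;
  they do not affect the integrals below, as a point has Lebesgue measure zero.
\<close>

definition weight :: "real \<Rightarrow> real \<Rightarrow> real \<Rightarrow> real \<Rightarrow> real \<Rightarrow> real ^ 'n \<Rightarrow> real" where
  "weight a b \<alpha> \<beta> s x = (a + b * norm x powr \<alpha>) powr \<beta> / norm x powr s"

text \<open>
  The integrands are nonnegative, so both sides are read as Lebesgue integrals with values in
  \<open>[0, \<infinity>]\<close>.  The right-hand integral can be infinite when \<open>u 0 \<noteq> 0\<close> and the exponents are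
  critical; the constant is then zero in the inequalities considered, and \<open>0 * \<infinity> = 0\<close>.
  The constant \<open>C\<close> is meant to be nonnegative (\<open>ennreal\<close> truncates negative reals to zero).
\<close>

definition hardy_inequality ::
    "(real ^ 'n \<Rightarrow> real) \<Rightarrow> (real ^ 'n \<Rightarrow> real) \<Rightarrow> real \<Rightarrow> bool" where
  "hardy_inequality V W C \<longleftrightarrow>
     (\<forall>u \<in> C0_infinity.
        (\<integral>\<^sup>+ x. ennreal (V x * (norm (grad u x))\<^sup>2) \<partial>lborel)
          \<ge> ennreal C * (\<integral>\<^sup>+ x. ennreal (W x * (u x)\<^sup>2) \<partial>lborel))"

definition best_constant :: "(real \<Rightarrow> bool) \<Rightarrow> real \<Rightarrow> bool" where
  "best_constant P c \<longleftrightarrow> (\<forall>C > c. \<not> P C)"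

end

(* Let c denote the square root of the constant and g = 0 in case (i), g = alpha * beta in case (ii),
   so that 2c = n - 2m - 2 + g.

   Inequality. Writing u(x) as minus the integral of d/dl u(l x) over l >= 1, Cauchy-Schwarz along
   the ray bounds u(x)^2 by (1/c) times the integral of l^(c+1) (x . grad u(l x))^2. Multiply by the
   weight, integrate in x and exchange the integrals. For l >= 1 the dilation x -> l x costs at most
   a power of l, because r^(-g) (a + b r^alpha)^beta is nondecreasing in r; the remaining integral of
   l^(-c-1) is 1/c. Everything is nonnegative, so no integrability has to be established.

   Sharpness. At 0 or at infinity the weights are asymptotic to powers of |x|. There the test
   functions |x|^(-c), cut off smoothly to N dyadic shells, have quotient c^2 + O(1/N): each shell
   has the same measure with respect to the dilation-invariant |x|^(-n) dx, and the two shells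
   carrying the cutoff contribute a bounded amount. *)
theory Submission
  imports Defs "HOL-Real_Asymp.Real_Asymp"
begin

subsection \<open>Smooth radial functions\<close>

definition flat_powr :: "real \<Rightarrow> real \<Rightarrow> real" where
  "flat_powr q s = (if s > 0 then s powr q * exp (- 1 / s) else 0)"

text \<open>Away from 0 this is the product rule. At 0 the difference quotient tends to 0 because
  exp(-1/s) decays faster than every power of s, so negative \<open>q\<close> is covered as
  well.\<close>

lemma flat_powr_has_real_derivative:
  "(flat_powr q has_real_derivative q * flat_powr (q - 1) s + flat_powr (q - 2) s) (at s)"
proof -
  consider "s < 0" | "s > 0" | "s = 0" by linarith
  then show ?thesis
  proof cases
    case 1
    have "((\<lambda>_. 0) has_real_derivative 0) (at s)" by simp
    then have "(flat_powr q has_real_derivative 0) (at s)"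
      by (rule has_field_derivative_transform_within_open[where S = "{..<0}"])
        (use 1 in \<open>auto simp: flat_powr_def\<close>)
    then show ?thesis using 1 by (simp add: flat_powr_def)
  next
    case 2
    have "((\<lambda>s. s powr q * exp (- 1 / s)) has_real_derivative
        q * flat_powr (q - 1) s + flat_powr (q - 2) s) (at s)"
      using 2 by (auto intro!: derivative_eq_intros
          simp: flat_powr_def powr_diff field_simps power2_eq_square)
    then show ?thesis
      by (rule has_field_derivative_transform_within_open[where S = "{0<..}"])
        (use 2 in \<open>auto simp: flat_powr_def\<close>)
  next
    case 3
    have right: "((\<lambda>h. h powr q * exp (- 1 / h) / h) \<longlongrightarrow> 0) (at_right 0)"
      by real_asymp
    have "((\<lambda>h. flat_powr q h / h) \<longlongrightarrow> 0) (at_right 0)"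
      using right by (rule tendsto_cong[THEN iffD1, rotated])
        (auto simp: flat_powr_def eventually_at_right_less eventually_at_filter)
    moreover have "((\<lambda>h. flat_powr q h / h) \<longlongrightarrow> 0) (at_left 0)"
      by (rule tendsto_cong[THEN iffD2, OF _ tendsto_const])
        (auto simp: flat_powr_def eventually_at_filter)
    ultimately have "((\<lambda>h. flat_powr q h / h) \<longlongrightarrow> 0) (at 0)"
      by (simp add: filterlim_split_at)
    then show ?thesis
      using 3 by (simp add: DERIV_def flat_powr_def)
  qed
qed

text \<open>
  Generating smooth functions by rules whose derivatives are again generated gives derivatives of
  all orders without a Leibniz or Faa di Bruno formula.  The exponent in \<open>flat_powr\<close> is there to
  make that family closed under differentiation.
\<close>

inductive smooth1 :: "(real \<Rightarrow> real) \<Rightarrow> bool" where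
  flat: "smooth1 (flat_powr q)"
| const: "smooth1 (\<lambda>_. c)"
| ident: "smooth1 (\<lambda>s. s)"
| add: "smooth1 f \<Longrightarrow> smooth1 g \<Longrightarrow> smooth1 (\<lambda>s. f s + g s)"
| mult: "smooth1 f \<Longrightarrow> smooth1 g \<Longrightarrow> smooth1 (\<lambda>s. f s * g s)"
| compose: "smooth1 f \<Longrightarrow> smooth1 g \<Longrightarrow> smooth1 (\<lambda>s. f (g s))"
| inverse: "smooth1 f \<Longrightarrow> (\<And>s. f s > 0) \<Longrightarrow> smooth1 (\<lambda>s. inverse (f s))"
| powr: "smooth1 f \<Longrightarrow> \<delta> > 0 \<Longrightarrow> (\<And>s. s < \<delta> \<Longrightarrow> f s = 0) \<Longrightarrow> smooth1 (\<lambda>s. s powr q * f s)"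

lemma smooth1_has_real_derivative:
  assumes "smooth1 f"
  obtains f' where "\<And>s. (f has_real_derivative f' s) (at s)" "smooth1 f'"
proof -
  have "\<exists>f'. (\<forall>s. (f has_real_derivative f' s) (at s)) \<and> smooth1 f'"
    using assms
  proof induction
    case (flat q)
    show ?case
      by (intro exI[of _ "\<lambda>s. q * flat_powr (q - 1) s + flat_powr (q - 2) s"] conjI allI
          flat_powr_has_real_derivative smooth1.add smooth1.mult smooth1.const smooth1.flat)
  next
    case (const c)
    show ?case by (intro exI[of _ "\<lambda>_. 0"]) (auto intro: smooth1.const)
  next
    case ident
    show ?case by (intro exI[of _ "\<lambda>_. 1"]) (auto intro: smooth1.const)
  next
    case (add f g)
    then obtain f' g' where D: "\<And>s. (f has_real_derivative f' s) (at s)" "smooth1 f'"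
      "\<And>s. (g has_real_derivative g' s) (at s)" "smooth1 g'" by blast
    show ?case
      by (intro exI[of _ "\<lambda>s. f' s + g' s"] conjI allI smooth1.add DERIV_add D)
  next
    case (mult f g)
    then obtain f' g' where D: "\<And>s. (f has_real_derivative f' s) (at s)" "smooth1 f'"
      "\<And>s. (g has_real_derivative g' s) (at s)" "smooth1 g'" by blast
    show ?case
      by (intro exI[of _ "\<lambda>s. f' s * g s + g' s * f s"] conjI allI smooth1.add smooth1.mult D
          mult.hyps DERIV_mult)
  next
    case (compose f g)
    then obtain f' g' where D: "\<And>s. (f has_real_derivative f' s) (at s)" "smooth1 f'"
      "\<And>s. (g has_real_derivative g' s) (at s)" "smooth1 g'" by blast
    show ?case
      by (intro exI[of _ "\<lambda>s. f' (g s) * g' s"] conjI allI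
          smooth1.mult smooth1.compose[OF D(2) compose.hyps(2)] D DERIV_chain2)
  next
    case (inverse f)
    then obtain f' where D: "\<And>s. (f has_real_derivative f' s) (at s)" "smooth1 f'" by blast
    have "f s \<noteq> 0" for s using inverse.hyps(2)[of s] by simp
    then have "((\<lambda>s. inverse (f s)) has_real_derivative
        (-1) * (f' s * (inverse (f s) * inverse (f s)))) (at s)" for s
      by (auto intro!: derivative_eq_intros D simp: field_simps)
    then show ?case
      by (intro exI[of _ "\<lambda>s. (-1) * (f' s * (inverse (f s) * inverse (f s)))"] conjI allI
          smooth1.mult smooth1.inverse smooth1.const D inverse.hyps)
  next
    case (powr f \<delta> q)
    then obtain f' where D: "\<And>s. (f has_real_derivative f' s) (at s)" "smooth1 f'" by blast
    \<comment> \<open>The derivative inherits the vanishing below \<open>\<delta>\<close>, so the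
      \<open>powr\<close> rule applies again to \<open>s powr q * f' s\<close>.\<close>
    have f'0: "f' s = 0" if "s < \<delta>" for s
    proof (rule DERIV_unique)
      have "((\<lambda>_. 0) has_real_derivative 0) (at s)" by simp
      then show "(f has_real_derivative 0) (at s)"
        by (rule has_field_derivative_transform_within_open[where S = "{..<\<delta>}"])
          (use that powr.hyps(3) in auto)
    qed (rule D)
    have "((\<lambda>s. s powr q * f s) has_real_derivative
        q * (s powr (q - 1) * f s) + s powr q * f' s) (at s)" for s
    proof (cases "s < \<delta>")
      case True
      have "((\<lambda>_. 0) has_real_derivative 0) (at s)" by simp
      then have "((\<lambda>s. s powr q * f s) has_real_derivative 0) (at s)"
        by (rule has_field_derivative_transform_within_open[where S = "{..<\<delta>}"])
          (use True powr.hyps(3) in auto)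
      then show ?thesis using True f'0 powr.hyps(3) by simp
    next
      case False
      then have "s > 0" using powr.hyps by simp
      then show ?thesis by (auto intro!: derivative_eq_intros D)
    qed
    moreover have "smooth1 (\<lambda>s. q * (s powr (q - 1) * f s) + s powr q * f' s)"
      by (intro smooth1.add smooth1.mult smooth1.const smooth1.powr[OF powr.hyps]
          smooth1.powr[OF D(2) powr.hyps(2) f'0])
    ultimately show ?case
      by (intro exI[of _ "\<lambda>s. q * (s powr (q - 1) * f s) + s powr q * f' s"]) simp
  qed
  then show thesis using that by blast
qed

text \<open>Functions of \<open>x \<bullet> x\<close> alone are not closed under directional
  derivatives: differentiating in direction \<open>v\<close> produces the factor
  \<open>x \<bullet> v\<close>. With these linear functions as further generators the family is
  closed.\<close>

inductive radially_smooth :: "(real ^ 'n \<Rightarrow> real) \<Rightarrow> bool" where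
  inner: "radially_smooth (\<lambda>x. x \<bullet> v)"
| const: "radially_smooth (\<lambda>_. c)"
| radial: "smooth1 f \<Longrightarrow> radially_smooth (\<lambda>x. f (x \<bullet> x))"
| add: "radially_smooth u \<Longrightarrow> radially_smooth v \<Longrightarrow> radially_smooth (\<lambda>x. u x + v x)"
| mult: "radially_smooth u \<Longrightarrow> radially_smooth v \<Longrightarrow> radially_smooth (\<lambda>x. u x * v x)"

lemma radially_smooth_has_derivative:
  assumes "radially_smooth u"
  shows "\<exists>D. (\<forall>x. (u has_derivative D x) (at x)) \<and> (\<forall>v. radially_smooth (\<lambda>x. D x v))"
  using assms
proof induction
  case (inner w)
  show ?case
    by (intro exI[of _ "\<lambda>x v. v \<bullet> w"] conjI allI radially_smooth.const)
      (auto intro!: derivative_eq_intros)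
next
  case (const c)
  show ?case
    by (intro exI[of _ "\<lambda>x v. 0"] conjI allI radially_smooth.const) auto
next
  case (radial f)
  obtain f' where D: "\<And>s. (f has_real_derivative f' s) (at s)" "smooth1 f'"
    using smooth1_has_real_derivative[OF radial] by blast
  have "((\<lambda>x. f (x \<bullet> x)) has_derivative (\<lambda>v. f' (x \<bullet> x) * (2 * (x \<bullet> v)))) (at x)" for x :: "real^'n"
    by (rule has_derivative_eq_rhs[OF DERIV_compose_FDERIV[where g = "\<lambda>x. x \<bullet> x", OF D(1)]])
      (auto intro!: derivative_eq_intros simp: inner_commute)
  then show ?case
    by (intro exI[of _ "\<lambda>x v. f' (x \<bullet> x) * (2 * (x \<bullet> v))"] conjI allI
        radially_smooth.mult radially_smooth.const radially_smooth.inner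
        radially_smooth.radial D)
next
  case (add u w)
  then obtain D E where D: "\<And>x. (u has_derivative D x) (at x)" "\<And>v. radially_smooth (\<lambda>x. D x v)"
    "\<And>x. (w has_derivative E x) (at x)" "\<And>v. radially_smooth (\<lambda>x. E x v)" by blast
  show ?case
    by (intro exI[of _ "\<lambda>x v. D x v + E x v"] conjI allI radially_smooth.add D
        has_derivative_add)
next
  case (mult u w)
  then obtain D E where D: "\<And>x. (u has_derivative D x) (at x)" "\<And>v. radially_smooth (\<lambda>x. D x v)"
    "\<And>x. (w has_derivative E x) (at x)" "\<And>v. radially_smooth (\<lambda>x. E x v)" by blast
  show ?case
    by (intro exI[of _ "\<lambda>x v. u x * E x v + D x v * w x"] conjI allI radially_smooth.add
        radially_smooth.mult D mult.hyps has_derivative_mult)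
qed

text \<open>Every directional derivative lies in the family again, so the recursion defining
  \<open>C_k\<close> never leaves it.\<close>

lemma radially_smooth_imp_C_k: "radially_smooth u \<Longrightarrow> C_k k u"
proof (induction k arbitrary: u)
  case 0
  then show ?case
    using radially_smooth_has_derivative[of u]
    by (auto simp: continuous_on_eq_continuous_at intro: has_derivative_continuous)
next
  case (Suc k)
  obtain D where D: "\<And>x. (u has_derivative D x) (at x)" "\<And>v. radially_smooth (\<lambda>x. D x v)"
    using radially_smooth_has_derivative[OF Suc.prems] by blast
  have "frechet_derivative u (at x) = D x" for x
    by (rule frechet_derivative_at[symmetric, OF D(1)])
  with Suc.IH[OF D(2)] D(1) show ?case
    by (auto simp: differentiable_def)
qed

lemma radial_in_C0_infinity:
  assumes "smooth1 f" and "\<And>s. s \<ge> R \<Longrightarrow> f s = 0"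
  shows "(\<lambda>x :: real ^ 'n. f (x \<bullet> x)) \<in> C0_infinity"
proof -
  have "norm x \<le> sqrt R" if "f (x \<bullet> x) \<noteq> 0" for x :: "real ^ 'n"
    using assms(2)[of "x \<bullet> x"] that by (force simp: norm_eq_sqrt_inner)
  then have "bounded {x :: real ^ 'n. f (x \<bullet> x) \<noteq> 0}"
    by (auto simp: bounded_iff)
  then show ?thesis
    by (auto simp: C0_infinity_def radially_smooth_imp_C_k radially_smooth.radial assms(1))
qed

lemma grad_radial:
  assumes "(f has_real_derivative f') (at (x \<bullet> x))"
  shows "grad (\<lambda>x :: real ^ 'n. f (x \<bullet> x)) x = (2 * f') *\<^sub>R x"
proof -
  have *: "((\<lambda>x :: real ^ 'n. f (x \<bullet> x)) has_derivative (\<lambda>v. v \<bullet> ((2 * f') *\<^sub>R x))) (at x)"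
    by (rule has_derivative_eq_rhs[OF DERIV_compose_FDERIV[where g = "\<lambda>x. x \<bullet> x", OF assms]])
      (auto intro!: derivative_eq_intros simp: inner_commute)
  then have "GDERIV (\<lambda>x. f (x \<bullet> x)) x :> grad (\<lambda>x. f (x \<bullet> x)) x"
    by (intro GDERIV_grad) (auto simp: differentiable_def)
  from has_derivative_unique[OF this[unfolded gderiv_def] *]
  have "\<forall>v. v \<bullet> grad (\<lambda>x. f (x \<bullet> x)) x = v \<bullet> ((2 * f') *\<^sub>R x)"
    by (metis (no_types))
  then show ?thesis by (metis vector_eq_ldot vector_eq_rdot)
qed

text \<open>
  The bound on \<open>(s + 1) \<sigma>'(s)\<close> controls \<open>s \<tau>'(s)\<close> for the rescaled steps
  \<open>\<tau>(s) = \<sigma>(s / r\<^sup>2 - 1)\<close>, uniformly in \<open>r\<close>.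
\<close>

lemma smooth_step_exists:
  obtains \<sigma> \<sigma>' :: "real \<Rightarrow> real" and L where
    "smooth1 \<sigma>" "\<And>s. (\<sigma> has_real_derivative \<sigma>' s) (at s)"
    "\<And>s. s \<le> 0 \<Longrightarrow> \<sigma> s = 0" "\<And>s. s \<ge> 1 \<Longrightarrow> \<sigma> s = 1" "\<And>s. 0 \<le> \<sigma> s \<and> \<sigma> s \<le> 1"
    "\<And>s. s < 0 \<Longrightarrow> \<sigma>' s = 0" "\<And>s. s > 1 \<Longrightarrow> \<sigma>' s = 0" "\<And>s. \<bar>(s + 1) * \<sigma>' s\<bar> \<le> L"
proof -
  \<comment> \<open>The usual smooth step h(s) / (h(s) + h(1 - s)) with h(s) = exp(-1/s) for s > 0.
    The form \<open>1 + (-1) * s\<close> matches the \<open>smooth1\<close> rules for sums and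
    products. The denominator is positive since s and 1 - s are never both nonpositive.\<close>
  define \<sigma> where "\<sigma> s = flat_powr 0 s * inverse (flat_powr 0 s + flat_powr 0 (1 + (-1) * s))" for s
  have pos: "flat_powr 0 s + flat_powr 0 (1 + (-1) * s) > 0" for s
    by (cases "s > 0") (auto simp: flat_powr_def intro: add_pos_pos)
  have "smooth1 \<sigma>"
    unfolding \<sigma>_def
    by (intro smooth1.mult smooth1.flat smooth1.inverse smooth1.add smooth1.compose[OF smooth1.flat]
        smooth1.const smooth1.ident pos)
  then obtain \<sigma>' where D: "\<And>s. (\<sigma> has_real_derivative \<sigma>' s) (at s)" "smooth1 \<sigma>'"
    using smooth1_has_real_derivative by blast
  have 0: "\<sigma> s = 0" if "s \<le> 0" for s using that by (simp add: \<sigma>_def flat_powr_def)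
  have 1: "\<sigma> s = 1" if "s \<ge> 1" for s using that by (simp add: \<sigma>_def flat_powr_def)
  have 01: "0 \<le> \<sigma> s \<and> \<sigma> s \<le> 1" for s
    using pos[of s] by (simp add: \<sigma>_def divide_simps flat_powr_def)
  have d0: "\<sigma>' s = 0" if "s < 0" for s
  proof (rule DERIV_unique)
    have "((\<lambda>_. 0) has_real_derivative 0) (at s)" by simp
    then show "(\<sigma> has_real_derivative 0) (at s)"
      by (rule has_field_derivative_transform_within_open[where S = "{..<0}"]) (use that 0 in auto)
  qed (rule D)
  have d1: "\<sigma>' s = 0" if "s > 1" for s
  proof (rule DERIV_unique)
    have "((\<lambda>_. 1) has_real_derivative 0) (at s)" by simp
    then show "(\<sigma> has_real_derivative 0) (at s)"
      by (rule has_field_derivative_transform_within_open[where S = "{1<..}"]) (use that 1 in auto)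
  qed (rule D)
  \<comment> \<open>Continuity bounds the product on the compact interval [0, 1]; outside it
    \<open>\<sigma>'\<close> vanishes.\<close>
  obtain L where L: "\<And>s. \<bar>(s + 1) * \<sigma>' s\<bar> \<le> L"
  proof -
    obtain \<sigma>'' where "\<And>s. (\<sigma>' has_real_derivative \<sigma>'' s) (at s)"
      using smooth1_has_real_derivative[OF D(2)] by blast
    then have "continuous_on {0..1} \<sigma>'"
      by (intro DERIV_continuous_on) (auto intro: has_field_derivative_at_within)
    then have "compact ((\<lambda>s. (s + 1) * \<sigma>' s) ` {0..1})"
      by (intro compact_continuous_image continuous_intros) auto
    then obtain L where "L > 0" "\<forall>y \<in> (\<lambda>s. (s + 1) * \<sigma>' s) ` {0..1}. norm y \<le> L"
      using compact_imp_bounded bounded_pos by meson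
    then have L: "L > 0" "\<And>s. s \<in> {0..1} \<Longrightarrow> \<bar>(s + 1) * \<sigma>' s\<bar> \<le> L"
      by auto
    have "\<bar>(s + 1) * \<sigma>' s\<bar> \<le> L" for s
      using L(2)[of s] L(1) d0[of s] d1[of s] by (cases "s < 0"; cases "s > 1") simp_all
    then show thesis by (rule that)
  qed
  show thesis
    by (rule that[OF \<open>smooth1 \<sigma>\<close> D(1) 0 1 01 d0 d1 L])
qed

subsection \<open>The inequality\<close>

lemma weight_nonneg: "weight a b \<alpha> \<beta> s x \<ge> 0"
  by (simp add: weight_def)

lemma weight_measurable [measurable]: "weight a b \<alpha> \<beta> s \<in> borel_measurable borel"
  unfolding weight_def by measurable

text \<open>At the origin both sides are 0, by the conventions \<open>0 powr s = 0\<close> and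
  \<open>y / 0 = 0\<close>.\<close>

lemma weight_norm_sq:
  fixes x :: "real ^ 'n"
  shows "weight a b \<alpha> \<beta> (2 * m + 2) x * (norm x)\<^sup>2 = weight a b \<alpha> \<beta> (2 * m) x"
  by (cases "x = 0") (simp_all add: weight_def powr_add powr_numeral)

lemma nn_integral_lborel_scaleR:
  fixes f :: "'a :: euclidean_space \<Rightarrow> ennreal"
  assumes [measurable]: "f \<in> borel_measurable borel" and "c \<noteq> 0"
  shows "(\<integral>\<^sup>+ x. f x \<partial>lborel) = ennreal (\<bar>c\<bar> ^ DIM('a)) * (\<integral>\<^sup>+ x. f (c *\<^sub>R x) \<partial>lborel)"
  by (subst lborel_affine[OF assms(2), of 0])
    (simp add: nn_integral_density nn_integral_distr nn_integral_cmult)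

section \<open>Gradient, continuity and bounded support of functions in
  \<open>C0_infinity\<close>\<close>

lemma C0_infinity_has_derivative:
  assumes "u \<in> C0_infinity"
  shows "(u has_derivative (\<lambda>v. v \<bullet> grad u x)) (at x)"
proof -
  have "C_k 1 u" using assms by (simp add: C0_infinity_def)
  then have "u differentiable (at x)" by simp
  then show ?thesis using GDERIV_grad unfolding gderiv_def by blast
qed

lemma C0_infinity_continuous_on: "u \<in> C0_infinity \<Longrightarrow> continuous_on S u"
  by (meson C0_infinity_has_derivative continuous_at_imp_continuous_on has_derivative_continuous)

lemma C0_infinity_continuous_on_grad:
  fixes u :: "real ^ 'n \<Rightarrow> real"
  assumes "u \<in> C0_infinity"
  shows "continuous_on UNIV (grad u)"
proof -
  have "C_k 1 u" using assms by (simp add: C0_infinity_def)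
  then have cont: "continuous_on UNIV (\<lambda>x. frechet_derivative u (at x) v)" for v
    by simp
  have "frechet_derivative u (at x) = (\<lambda>v. v \<bullet> grad u x)" for x
    by (rule frechet_derivative_at[symmetric, OF C0_infinity_has_derivative[OF assms]])
  with cont have "continuous_on UNIV (\<lambda>x. grad u x \<bullet> v)" for v
    by (simp add: inner_commute)
  then show ?thesis
    by (subst continuous_on_componentwise) auto
qed

lemma C0_infinity_bounded_support:
  assumes "u \<in> C0_infinity"
  obtains R where "\<And>x. norm x > R \<Longrightarrow> u x = 0"
proof -
  have "bounded {x. u x \<noteq> 0}"
    using assms compact_imp_bounded bounded_subset closure_subset
    unfolding C0_infinity_def by blast
  then show thesis using that unfolding bounded_iff by (metis (mono_tags) leD mem_Collect_eq)
qed

text \<open>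
  Cauchy--Schwarz along the ray through \<open>x\<close>, obtained by integrating
  \<open>- (l\<^sup>c g\<^sup>2)' \<le> l\<^sup>c\<^sup>+\<^sup>1 g'\<^sup>2 / c\<close> for \<open>g l = u (l x)\<close>.
\<close>

lemma square_le_ray_integral:
  fixes u :: "real ^ 'n \<Rightarrow> real"
  assumes u: "u \<in> C0_infinity" and c: "c > 0" and x: "x \<noteq> 0"
  shows "ennreal ((u x)\<^sup>2) \<le>
    (\<integral>\<^sup>+ l. ennreal (l powr (c + 1) / c * (x \<bullet> grad u (l *\<^sub>R x))\<^sup>2) * indicator {1..} l \<partial>lborel)"
proof -
  define g where "g l = u (l *\<^sub>R x)" for l
  define g' where "g' l = x \<bullet> grad u (l *\<^sub>R x)" for l
  define p where "p l = l powr (c + 1) / c * (g' l)\<^sup>2" for l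
  have Dg: "(g has_real_derivative g' l) (at l)" for l
  proof -
    have "((\<lambda>l. u (l *\<^sub>R x)) has_derivative (\<lambda>h. (h *\<^sub>R x) \<bullet> grad u (l *\<^sub>R x))) (at l)"
      by (rule has_derivative_compose[OF _ C0_infinity_has_derivative[OF u], where f = "\<lambda>l. l *\<^sub>R x"])
        (auto intro!: derivative_eq_intros)
    then show ?thesis
      by (simp add: has_field_derivative_def g_def[abs_def] g'_def mult_commute_abs)
  qed
  obtain R where R: "\<And>y. norm y > R \<Longrightarrow> u y = 0"
    using C0_infinity_bounded_support[OF u] by blast
  \<comment> \<open>At parameter \<open>l0\<close> the ray has left the support: the norm of
    \<open>l0 *\<^sub>R x\<close> is at least \<bar>R\<bar> + norm x.\<close>
  define l0 where "l0 = max 1 (\<bar>R\<bar> / norm x + 1)"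
  have "norm (l0 *\<^sub>R x) > R"
  proof -
    have "(\<bar>R\<bar> / norm x + 1) * norm x \<le> l0 * norm x"
      by (intro mult_right_mono) (auto simp: l0_def)
    moreover have "(\<bar>R\<bar> / norm x + 1) * norm x = \<bar>R\<bar> + norm x"
      using x by (simp add: field_simps)
    moreover have "norm (l0 *\<^sub>R x) = l0 * norm x" by (simp add: l0_def)
    moreover have "norm x > 0" using x by simp
    ultimately show ?thesis by linarith
  qed
  then have gl0: "g l0 = 0" using R by (simp add: g_def)
  have l0: "1 \<le> l0" by (simp add: l0_def)
  have "continuous_on {1..l0} (\<lambda>l. grad u (l *\<^sub>R x))"
    by (rule continuous_on_compose2[OF C0_infinity_continuous_on_grad[OF u]])
      (auto intro!: continuous_intros)
  then have "continuous_on {1..l0} p"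
    unfolding p_def g'_def by (intro continuous_intros) (use c in auto)
  then have p: "(p has_integral integral {1..l0} p) {1..l0}"
    by (intro integrable_integral integrable_continuous_real)
  \<comment> \<open>The derivative of \<open>- (l powr c * (g l)\<^sup>2)\<close>. As
    \<open>g l0 = 0\<close>, its integral is the boundary term at 1, which is the square of
    u(x).\<close>
  define q where "q l = - (c * l powr (c - 1) * (g l)\<^sup>2 + l powr c * (2 * g l * g' l))" for l
  have "(q has_integral (- (l0 powr c * (g l0)\<^sup>2)) - (- (1 powr c * (g 1)\<^sup>2))) {1..l0}"
  proof (rule fundamental_theorem_of_calculus[OF l0])
    fix l assume l: "l \<in> {1..l0}"
    have "((\<lambda>l. - (l powr c * (g l)\<^sup>2)) has_real_derivative q l) (at l)"
      using l by (auto intro!: derivative_eq_intros Dg simp: q_def)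
    then show "((\<lambda>l. - (l powr c * (g l)\<^sup>2)) has_vector_derivative q l) (at l within {1..l0})"
      using has_field_derivative_at_within has_real_derivative_iff_has_vector_derivative by blast
  qed
  then have q: "(q has_integral (g 1)\<^sup>2) {1..l0}" by (simp add: gl0)
  have "(g 1)\<^sup>2 \<le> integral {1..l0} p"
  proof (rule has_integral_le[OF q p])
    fix l assume l: "l \<in> {1..l0}"
    then have 1: "l powr c = l powr (c - 1) * l" "l powr (c + 1) = l powr (c - 1) * l * l"
      by (auto simp: powr_add powr_diff)
    \<comment> \<open>Completing the square. Equality holds where c g + l g' = 0, that is for g
      proportional to l^(-c); this is the profile of the functions used for sharpness.\<close>
    have "p l - q l = l powr (c - 1) / c * (c * g l + l * g' l)\<^sup>2"
      unfolding p_def q_def 1 using c by (simp add: field_simps power2_eq_square)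
    moreover have "\<dots> \<ge> 0" using c by simp
    ultimately show "q l \<le> p l" by linarith
  qed
  then have "ennreal ((u x)\<^sup>2) \<le> ennreal (integral {1..l0} p)"
    by (simp add: g_def ennreal_leI)
  also have "\<dots> = (\<integral>\<^sup>+ l. ennreal (p l) * indicator {1..l0} l \<partial>lborel)"
    by (rule nn_integral_has_integral_lebesgue'[symmetric, OF _ p]) (use c in \<open>simp add: p_def\<close>)
  also have "\<dots> \<le> (\<integral>\<^sup>+ l. ennreal (p l) * indicator {1..} l \<partial>lborel)"
    by (intro nn_integral_mono) (auto split: split_indicator)
  finally show ?thesis by (simp add: p_def g'_def)
qed

lemma nn_integral_powr_atLeast_one:
  fixes c :: real
  assumes "c > 0"
  shows "(\<integral>\<^sup>+ l. ennreal (l powr (- c - 1)) * indicator {1..} l \<partial>lborel) = ennreal (1 / c)"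
proof -
  have "(\<integral>\<^sup>+ l. ennreal (l powr (- c - 1)) * indicator {1..} l \<partial>lborel)
      = ennreal (0 - (- (1 powr (- c)) / c))"
  proof (rule nn_integral_FTC_atLeast)
    fix l :: real assume "1 \<le> l"
    then show "((\<lambda>l. - (l powr (- c)) / c) has_real_derivative l powr (- c - 1)) (at l)"
      using assms by (auto intro!: derivative_eq_intros)
    show "0 \<le> l powr (- c - 1)" by simp
  next
    have "((\<lambda>l. - (l powr (- c)) / c) \<longlongrightarrow> - 0 / c) at_top"
      by (intro tendsto_intros tendsto_neg_powr filterlim_ident) (use assms in auto)
    then show "((\<lambda>l. - (l powr (- c)) / c) \<longlongrightarrow> 0) at_top" by simp
  qed measurable
  then show ?thesis by simp
qed

text \<open>The parameter \<open>\<gamma>\<close> covers both cases at once: 0 in (i) and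
  \<open>\<alpha> * \<beta>\<close> in (ii). Assumption \<open>mono\<close> expresses that
  r^(-\<gamma>) (a + b r^\<alpha>)^\<beta> is nondecreasing, in the form in which it bounds the
  effect of a dilation by l.\<close>

lemma hardy_inequality_weight:
  fixes a b \<alpha> \<beta> m c \<gamma> :: real
  assumes c: "c \<ge> 0" and c_eq: "2 * c = real CARD('n) - 2 * m - 2 + \<gamma>"
    and mono: "\<And>l r. l \<ge> 1 \<Longrightarrow> r > 0 \<Longrightarrow>
      (a + b * (r / l) powr \<alpha>) powr \<beta> \<le> l powr (- \<gamma>) * (a + b * r powr \<alpha>) powr \<beta>"
  shows "hardy_inequality (weight a b \<alpha> \<beta> (2 * m)) (weight a b \<alpha> \<beta> (2 * m + 2) :: real ^ 'n \<Rightarrow> real)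
    (c\<^sup>2)"
\<comment> \<open>For \<open>c = 0\<close> the right-hand side is 0 even if its integral is
  infinite. The main argument divides by \<open>c\<close>.\<close>
proof (cases "c = 0")
  case True
  then show ?thesis by (simp add: hardy_inequality_def)
next
  case False
  with c have c: "c > 0" by simp
  let ?V = "weight a b \<alpha> \<beta> (2 * m) :: real ^ 'n \<Rightarrow> real"
  let ?W = "weight a b \<alpha> \<beta> (2 * m + 2) :: real ^ 'n \<Rightarrow> real"
  \<comment> \<open>The factor l^(2m) comes from the power of the norm in the weight, the factor
    l^(-\<gamma>) from \<open>mono\<close>.\<close>
  have V_scale: "?V x \<le> l powr (2 * m - \<gamma>) * ?V (l *\<^sub>R x)" if l: "l \<ge> 1" for l x
  proof (cases "x = 0")
    case True
    then show ?thesis by (simp add: weight_def)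
  next
    case False
    have "(a + b * norm x powr \<alpha>) powr \<beta> \<le> l powr (- \<gamma>) * (a + b * (l * norm x) powr \<alpha>) powr \<beta>"
      using mono[of l "l * norm x"] l False by simp
    then have "?V x \<le> l powr (- \<gamma>) * (a + b * (l * norm x) powr \<alpha>) powr \<beta> / norm x powr (2 * m)"
      unfolding weight_def by (intro divide_right_mono) auto
    also have "\<dots> = l powr (2 * m - \<gamma>) * ?V (l *\<^sub>R x)"
      using l False by (simp add: weight_def powr_mult powr_diff powr_minus field_simps)
    finally show ?thesis .
  qed
  show ?thesis
    unfolding hardy_inequality_def
  proof
    fix u :: "real ^ 'n \<Rightarrow> real"
    assume u: "u \<in> C0_infinity"
    note [measurable] = borel_measurable_continuous_onI[OF C0_infinity_continuous_on_grad[OF u]]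
      borel_measurable_continuous_onI[OF C0_infinity_continuous_on[OF u]]
    define A where "A = (\<integral>\<^sup>+ x. ennreal (?V x * (norm (grad u x))\<^sup>2) \<partial>lborel)"
    define B where "B = (\<integral>\<^sup>+ x. ennreal (?W x * (u x)\<^sup>2) \<partial>lborel)"
    \<comment> \<open>The weight times the integrand of the ray estimate, kept as a function of both
      variables so that the order of integration can be exchanged.\<close>
    define K where "K l x = ennreal (?W x * (l powr (c + 1) / c * (x \<bullet> grad u (l *\<^sub>R x))\<^sup>2)) * indicator {1..} l"
      for l x
    have K_measurable: "(\<lambda>(x, l). K l x) \<in> borel_measurable (lborel \<Otimes>\<^sub>M lborel)"
      unfolding K_def case_prod_unfold by measurable
    have ray: "(\<integral>\<^sup>+ x. K l x \<partial>lborel) \<le> ennreal (l powr (- c - 1)) * indicator {1..} l * (ennreal (1 / c) * A)"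
      for l
    proof (cases "l \<ge> 1")
      case True
      define G where "G y = ennreal (?V y * (norm (grad u y))\<^sup>2)" for y
      have [measurable]: "G \<in> borel_measurable borel" unfolding G_def by measurable
      define k where "k = l powr (c + 1) / c * l powr (2 * m - \<gamma>)"
      have k: "k \<ge> 0" using c by (simp add: k_def)
      have "K l x \<le> ennreal k * G (l *\<^sub>R x)" for x
      proof -
        have "?W x * (x \<bullet> grad u (l *\<^sub>R x))\<^sup>2 \<le> ?W x * (norm x * norm (grad u (l *\<^sub>R x)))\<^sup>2"
          by (intro mult_left_mono weight_nonneg)
            (metis Cauchy_Schwarz_ineq2 abs_ge_zero power2_abs power_mono)
        also have "\<dots> = ?V x * (norm (grad u (l *\<^sub>R x)))\<^sup>2"
          by (simp add: weight_norm_sq[symmetric] power_mult_distrib)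
        also have "\<dots> \<le> l powr (2 * m - \<gamma>) * ?V (l *\<^sub>R x) * (norm (grad u (l *\<^sub>R x)))\<^sup>2"
          by (intro mult_right_mono V_scale True) auto
        finally have "l powr (c + 1) / c * (?W x * (x \<bullet> grad u (l *\<^sub>R x))\<^sup>2) \<le>
            l powr (c + 1) / c * (l powr (2 * m - \<gamma>) * ?V (l *\<^sub>R x) * (norm (grad u (l *\<^sub>R x)))\<^sup>2)"
          by (intro mult_left_mono) (use c in auto)
        then show ?thesis
          using True k by (simp add: K_def G_def k_def ennreal_mult'[symmetric] ennreal_leI mult_ac)
      qed
      then have "(\<integral>\<^sup>+ x. K l x \<partial>lborel) \<le> ennreal k * (\<integral>\<^sup>+ x. G (l *\<^sub>R x) \<partial>lborel)"
        by (subst nn_integral_cmult[symmetric]) (auto intro!: nn_integral_mono)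
      also have "\<dots> = ennreal (l powr (- c - 1)) * (ennreal (1 / c) * A)"
      proof -
        have k_eq: "k = l powr (- c - 1) * (1 / c) * l ^ CARD('n)"
        proof -
          \<comment> \<open>Here the value of \<open>c\<close> enters: after the Jacobian l^n of the
            dilation is taken out, the remaining power of l is l^(-c-1), which is integrable on [1,
            \<infinity>).\<close>
          have "c + 1 + (2 * m - \<gamma>) = - c - 1 + real CARD('n)"
            using c_eq by simp
          then have "l powr (c + 1) * l powr (2 * m - \<gamma>) = l powr (- c - 1) * l powr (real CARD('n))"
            by (simp only: powr_add[symmetric])
          then show ?thesis using True by (simp add: k_def powr_realpow)
        qed
        have "A = ennreal (l ^ CARD('n)) * (\<integral>\<^sup>+ x. G (l *\<^sub>R x) \<partial>lborel)"
          unfolding A_def G_def[symmetric]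
          using True by (subst nn_integral_lborel_scaleR[of G l]) auto
        then show ?thesis
          unfolding k_eq using c True
          by (simp only: ennreal_mult' powr_ge_zero zero_le_power zero_le_divide_1_iff
              mult_nonneg_nonneg less_imp_le mult.assoc ac_simps)
      qed
      finally show ?thesis using True by simp
    qed (simp add: K_def)
    have "B \<le> (\<integral>\<^sup>+ x. (\<integral>\<^sup>+ l. K l x \<partial>lborel) \<partial>lborel)"
      unfolding B_def
    proof (rule nn_integral_mono)
      fix x :: "real ^ 'n"
      show "ennreal (?W x * (u x)\<^sup>2) \<le> (\<integral>\<^sup>+ l. K l x \<partial>lborel)"
      proof (cases "x = 0")
        case True
        then show ?thesis by (simp add: weight_def)
      next
        case False
        have "ennreal (?W x * (u x)\<^sup>2) = ennreal (?W x) * ennreal ((u x)\<^sup>2)"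
          by (simp add: ennreal_mult' weight_nonneg)
        also have "\<dots> \<le> ennreal (?W x) * (\<integral>\<^sup>+ l. ennreal (l powr (c + 1) / c * (x \<bullet> grad u (l *\<^sub>R x))\<^sup>2) * indicator {1..} l \<partial>lborel)"
          by (intro mult_left_mono square_le_ray_integral u c False) auto
        also have "\<dots> = (\<integral>\<^sup>+ l. K l x \<partial>lborel)"
          by (subst nn_integral_cmult[symmetric])
            (simp_all only: K_def ennreal_mult'[OF weight_nonneg] mult.assoc, measurable)
        finally show ?thesis .
      qed
    qed
    also have "\<dots> = (\<integral>\<^sup>+ l. (\<integral>\<^sup>+ x. K l x \<partial>lborel) \<partial>lborel)"
      using lborel_pair.Fubini'[OF K_measurable] by simp
    also have "\<dots> \<le> (\<integral>\<^sup>+ l. ennreal (l powr (- c - 1)) * indicator {1..} l * (ennreal (1 / c) * A) \<partial>lborel)"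
      by (intro nn_integral_mono ray)
    \<comment> \<open>One factor 1/c stems from the ray estimate, the other from the integral of
      l^(-c-1).\<close>
    also have "\<dots> = ennreal (1 / c) * (ennreal (1 / c) * A)"
      by (subst nn_integral_multc) (auto simp: nn_integral_powr_atLeast_one[OF c])
    finally have "ennreal (c\<^sup>2) * B \<le> ennreal (c\<^sup>2) * (ennreal (1 / c) * (ennreal (1 / c) * A))"
      by (intro mult_left_mono) auto
    also have "\<dots> = A"
    proof -
      have "ennreal (c\<^sup>2) * (ennreal (1 / c) * ennreal (1 / c)) = 1"
        using c by (simp add: ennreal_mult'[symmetric] power2_eq_square)
      then show ?thesis by (simp add: mult.assoc[symmetric])
    qed
    finally show "ennreal (c\<^sup>2) * B \<le> A" .
  qed
qed

subsection \<open>Sharpness of the constant\<close>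

text \<open>The density |x|^(-n) makes Lebesgue measure invariant under dilations. The half-open
  bounds let adjacent shells fit together without overlap.\<close>

definition annulus_measure :: "'n :: finite itself \<Rightarrow> real \<Rightarrow> real \<Rightarrow> ennreal" where
  "annulus_measure TYPE('n) p q =
    (\<integral>\<^sup>+ x. ennreal (norm x powr (- real CARD('n))) * indicator {x :: real ^ 'n. p \<le> norm x \<and> norm x < q} x \<partial>lborel)"

text \<open>The Jacobian t^n of the dilation cancels the factor t^(-n) from the density.\<close>

lemma annulus_measure_scale:
  assumes t: "t > 0"
  shows "annulus_measure TYPE('n :: finite) (t * p) (t * q) = annulus_measure TYPE('n) p q"
proof -
  have "ennreal (t ^ CARD('n)) * (ennreal (norm (t *\<^sub>R x) powr (- real CARD('n))) *
      indicator {x. t * p \<le> norm x \<and> norm x < t * q} (t *\<^sub>R x)) =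
    ennreal (norm x powr (- real CARD('n))) * indicator {x. p \<le> norm x \<and> norm x < q} x"
    for x :: "real ^ 'n"
    using t by (simp add: indicator_def powr_mult powr_minus powr_realpow ennreal_mult'[symmetric])
  then show ?thesis
    unfolding annulus_measure_def using t
    by (subst nn_integral_lborel_scaleR[where c = t]) (simp_all add: nn_integral_cmult[symmetric])
qed

lemma annulus_measure_add:
  assumes "p \<le> q" "q \<le> r"
  shows "annulus_measure TYPE('n :: finite) p r = annulus_measure TYPE('n) p q + annulus_measure TYPE('n) q r"
  unfolding annulus_measure_def
  by (subst nn_integral_add[symmetric])
    (use assms in \<open>auto intro!: nn_integral_cong simp: indicator_def\<close>)

text \<open>The annulus splits into N shells with radii in ratio 2, and by scaling each has the
  measure of the shell from 1 to 2.\<close>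

lemma annulus_measure_dyadic:
  assumes "p > 0"
  shows "annulus_measure TYPE('n :: finite) p (p * 2 ^ N) = of_nat N * annulus_measure TYPE('n) 1 2"
proof (induction N)
  case 0
  have "{x :: real ^ 'n. p \<le> norm x \<and> norm x < p} = {}" by auto
  then show ?case by (simp add: annulus_measure_def)
next
  case (Suc N)
  have "annulus_measure TYPE('n) p (p * 2 ^ Suc N) =
      annulus_measure TYPE('n) p (p * 2 ^ N) + annulus_measure TYPE('n) (p * 2 ^ N) (p * 2 ^ Suc N)"
    using assms by (intro annulus_measure_add) auto
  also have "annulus_measure TYPE('n) (p * 2 ^ N) (p * 2 ^ Suc N) = annulus_measure TYPE('n) 1 2"
    using annulus_measure_scale[of "p * 2 ^ N" 1 2] assms by (simp add: mult_ac)
  finally show ?case using Suc by (simp add: algebra_simps)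
qed

lemma annulus_measure_finite: "annulus_measure TYPE('n :: finite) 1 2 < \<infinity>"
proof -
  have "annulus_measure TYPE('n) 1 2 \<le> (\<integral>\<^sup>+ x. indicator (ball (0 :: real ^ 'n) 2) x \<partial>lborel)"
    unfolding annulus_measure_def
    by (intro nn_integral_mono) (auto simp: indicator_def powr_minus_divide divide_simps ge_one_powr_ge_zero)
  also have "\<dots> < \<infinity>"
    using emeasure_lborel_ball_finite[of 0 2] by (simp del: emeasure_lborel_ball_finite)
  finally show ?thesis .
qed

text \<open>Measure zero would make the open shell 1 < |x| < 2 Lebesgue negligible, although it
  contains a vector of norm 3/2.\<close>

lemma annulus_measure_pos: "annulus_measure TYPE('n :: finite) 1 2 > 0"
proof (rule ccontr)
  let ?S = "{x :: real ^ 'n. 1 < norm x \<and> norm x < 2}"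
  assume "\<not> ?thesis"
  then have "(\<integral>\<^sup>+ x. ennreal (norm x powr (- real CARD('n))) * indicator {x :: real ^ 'n. 1 \<le> norm x \<and> norm x < 2} x \<partial>lborel) = 0"
    by (simp add: annulus_measure_def)
  then have "AE x :: real ^ 'n in lborel. ennreal (norm x powr (- real CARD('n))) * indicator {x. 1 \<le> norm x \<and> norm x < 2} x = 0"
    by (subst (asm) nn_integral_0_iff_AE) auto
  then have "AE x :: real ^ 'n in lborel. x \<notin> ?S"
    by (rule AE_mp) (auto intro!: AE_I2 simp: indicator_def split: if_splits)
  then have "?S \<in> null_sets lborel"
    by (subst (asm) AE_iff_null) auto
  then have "negligible ?S"
    using negligible_iff_null_sets null_sets_completionI by blast
  moreover have "open ?S"
    by (intro open_Collect_conj open_Collect_less continuous_intros)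
  moreover obtain x :: "real ^ 'n" where "norm x = 3 / 2"
    using vector_choose_size[of "3 / 2"] by auto
  then have "x \<in> ?S" by simp
  ultimately show False
    using open_not_negligible by blast
qed

lemma hardy_constant_le:
  fixes V W :: "real ^ 'n \<Rightarrow> real" and c C :: real
  assumes hardy: "hardy_inequality V W C"
    and power_like: "\<And>\<delta> N. \<delta> > 1 \<Longrightarrow> \<exists>\<rho>>0. \<exists>K>0. \<forall>x. \<rho> \<le> norm x \<and> norm x \<le> \<rho> * 2 ^ N \<longrightarrow>
      K * norm x powr (2 * c - real CARD('n)) \<le> W x \<and>
      V x \<le> \<delta> * K * norm x powr (2 * c - real CARD('n) + 2)"
  shows "C \<le> c\<^sup>2"
proof (rule ccontr)
  assume "\<not> C \<le> c\<^sup>2"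
  then have C: "c\<^sup>2 < C" by simp
  obtain \<sigma> \<sigma>' L where \<sigma>: "smooth1 \<sigma>" "\<And>s. (\<sigma> has_real_derivative \<sigma>' s) (at s)"
    "\<And>s. s \<le> 0 \<Longrightarrow> \<sigma> s = 0" "\<And>s. s \<ge> 1 \<Longrightarrow> \<sigma> s = 1" "\<And>s. 0 \<le> \<sigma> s \<and> \<sigma> s \<le> 1"
    "\<And>s. s < 0 \<Longrightarrow> \<sigma>' s = 0" "\<And>s. s > 1 \<Longrightarrow> \<sigma>' s = 0" "\<And>s. \<bar>(s + 1) * \<sigma>' s\<bar> \<le> L"
    using smooth_step_exists by blast
  define M where "M = (\<bar>c\<bar> + 4 * L)\<^sup>2"
  obtain \<delta> where \<delta>: "\<delta> > 1" "\<delta> * c\<^sup>2 < C"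
  proof
    \<comment> \<open>Half of the gap between \<open>c\<^sup>2\<close> and \<open>C\<close>, divided
      by \<open>c\<^sup>2 + 1\<close> rather than \<open>c\<^sup>2\<close> so that
      \<open>c = 0\<close> is allowed.\<close>
    define d where "d = (C - c\<^sup>2) / (2 * (c\<^sup>2 + 1))"
    have pos: "c\<^sup>2 + 1 > 0" by (simp add: add_nonneg_pos)
    then have d: "d > 0" using C by (simp add: d_def)
    then show "1 + d > 1" by simp
    have "d * (c\<^sup>2 + 1) = (C - c\<^sup>2) / 2" using pos by (simp add: d_def divide_simps)
    then have "2 * (d * c\<^sup>2) + 2 * d = C - c\<^sup>2" by (simp add: distrib_left)
    moreover have "d * c\<^sup>2 \<ge> 0" using d by simp
    moreover have "(1 + d) * c\<^sup>2 = c\<^sup>2 + d * c\<^sup>2" by (simp add: distrib_right)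
    ultimately show "(1 + d) * c\<^sup>2 < C" using d by linarith
  qed
  \<comment> \<open>With this many inner shells, each weighted by \<open>c\<^sup>2\<close>, the two
    cutoff shells, each weighted by \<open>M\<close>, cannot close the gap left by
    \<open>\<delta>\<close>.\<close>
  obtain N :: nat where "2 * \<delta> * M / (C - \<delta> * c\<^sup>2) < real N"
    using reals_Archimedean2 by blast
  then have N: "\<delta> * (2 * M + c\<^sup>2 * real N) < C * real N"
    using \<delta> by (simp add: field_simps)
  \<comment> \<open>N + 2 shells: one for the rise of the cutoff, N for its plateau from
    \<open>2 * \<rho>\<close> to \<open>\<rho>'\<close>, and one for its descent.\<close>
  obtain \<rho> K where \<rho>: "\<rho> > 0" and K: "K > 0" and VW:
    "\<And>x. \<rho> \<le> norm x \<Longrightarrow> norm x \<le> \<rho> * 2 ^ (N + 2) \<Longrightarrow>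
      K * norm x powr (2 * c - real CARD('n)) \<le> W x \<and>
      V x \<le> \<delta> * K * norm x powr (2 * c - real CARD('n) + 2)"
    using power_like[OF \<delta>(1), of "N + 2"] by blast

  \<comment> \<open>Smooth radial cutoff to dyadic shells\<close>
  define \<rho>' where "\<rho>' = \<rho> * 2 ^ (N + 1)"
  have "1 \<le> 2 * (2 :: real) ^ N" using two_realpow_ge_one[of N] by linarith
  then have \<rho>': "\<rho>' > 0" "\<rho> \<le> \<rho>'" "2 * \<rho> \<le> \<rho>'" "2 * \<rho>' = \<rho> * 2 ^ (N + 2)" 
    using \<rho> by (simp_all add: \<rho>'_def)
  \<comment> \<open>The variable \<open>s\<close> stands for the squared norm. The transition takes
    place for s between r^2 and 2 r^2, hence inside the shell r \<le> |x| < 2 r.\<close>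
  define \<tau> where "\<tau> r s = \<sigma> (s / r\<^sup>2 - 1)" for r s :: real
  define \<tau>' where "\<tau>' r s = \<sigma>' (s / r\<^sup>2 - 1) / r\<^sup>2" for r s :: real
  have \<tau>: "smooth1 (\<tau> r)" for r
  proof -
    have "smooth1 (\<lambda>s. \<sigma> (inverse (r\<^sup>2) * s + (-1)))"
      by (intro smooth1.compose[OF \<sigma>(1)] smooth1.add smooth1.mult smooth1.const smooth1.ident)
    then show ?thesis by (simp add: \<tau>_def[abs_def] divide_inverse mult.commute)
  qed
  have D\<tau>: "(\<tau> r has_real_derivative \<tau>' r s) (at s)" for r s
  proof -
    have "((\<lambda>s. s / r\<^sup>2 - 1) has_real_derivative 1 / r\<^sup>2 - 0) (at s)"
      by (intro DERIV_diff DERIV_cdivide DERIV_ident DERIV_const)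
    from DERIV_chain2[OF \<sigma>(2) this] show ?thesis
      by (simp add: \<tau>_def[abs_def] \<tau>'_def)
  qed
  have \<tau>_low: "\<tau> r s = 0 \<and> \<tau>' r s = 0" if "r > 0" "s < r\<^sup>2" for r s
  proof -
    have "s / r\<^sup>2 < 1" using that by simp
    then show ?thesis using \<sigma>(3,6)[of "s / r\<^sup>2 - 1"] by (simp add: \<tau>_def \<tau>'_def)
  qed
  have \<tau>_high: "\<tau> r s = 1 \<and> \<tau>' r s = 0" if "r > 0" "s \<ge> (2 * r)\<^sup>2" for r s
  proof -
    have "s / r\<^sup>2 \<ge> 4" using that by (simp add: field_simps power2_eq_square)
    then show ?thesis using \<sigma>(4,7)[of "s / r\<^sup>2 - 1"] by (simp add: \<tau>_def \<tau>'_def)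
  qed
  have \<tau>_bounds: "0 \<le> \<tau> r s" "\<tau> r s \<le> 1" for r s
    using \<sigma>(5) by (simp_all add: \<tau>_def)
  have \<tau>'_bound: "\<bar>s * \<tau>' r s\<bar> \<le> L" for r s
    using \<sigma>(8)[of "s / r\<^sup>2 - 1"] by (simp add: \<tau>'_def)
  define \<eta> where "\<eta> s = \<tau> \<rho> s * (1 + (-1) * \<tau> \<rho>' s)" for s
  define \<eta>' where "\<eta>' s = \<tau>' \<rho> s * (1 + (-1) * \<tau> \<rho>' s) - \<tau> \<rho> s * \<tau>' \<rho>' s" for s
  have D\<eta>: "(\<eta> has_real_derivative \<eta>' s) (at s)" for s
    unfolding \<eta>_def[abs_def] \<eta>'_def
    by (auto intro!: derivative_eq_intros D\<tau> simp: algebra_simps)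
  have \<eta>_low: "\<eta> s = 0" if "s < \<rho>\<^sup>2" for s
    using \<tau>_low[OF \<rho> that] by (simp add: \<eta>_def)
  have \<eta>_out: "\<eta> s = 0 \<and> \<eta>' s = 0" if "s < \<rho>\<^sup>2 \<or> s \<ge> (2 * \<rho>')\<^sup>2" for s
    using that \<tau>_low[OF \<rho>, of s] \<tau>_high[OF \<rho>'(1), of s] by (auto simp: \<eta>_def \<eta>'_def)
  have \<eta>_mid: "\<eta> s = 1 \<and> \<eta>' s = 0" if "s \<ge> (2 * \<rho>)\<^sup>2" "s < \<rho>'\<^sup>2" for s
    using \<tau>_high[OF \<rho> that(1)] \<tau>_low[OF \<rho>'(1) that(2)] by (auto simp: \<eta>_def \<eta>'_def)
  have \<eta>_bounds: "0 \<le> \<eta> s" "\<eta> s \<le> 1" for s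
    using \<tau>_bounds[of \<rho> s] \<tau>_bounds[of \<rho>' s] by (auto simp: \<eta>_def intro!: mult_le_one)
  have \<eta>'_bound: "\<bar>s * \<eta>' s\<bar> \<le> 2 * L" for s
  proof -
    have "s * \<eta>' s = (s * \<tau>' \<rho> s) * (1 - \<tau> \<rho>' s) - \<tau> \<rho> s * (s * \<tau>' \<rho>' s)"
      by (simp add: \<eta>'_def algebra_simps)
    also have "\<bar>\<dots>\<bar> \<le> \<bar>s * \<tau>' \<rho> s\<bar> * \<bar>1 - \<tau> \<rho>' s\<bar> + \<bar>\<tau> \<rho> s\<bar> * \<bar>s * \<tau>' \<rho>' s\<bar>"
      unfolding abs_mult[symmetric] by (rule abs_triangle_ineq4)
    also have "\<dots> \<le> L * 1 + 1 * L"
      using \<tau>_bounds[of \<rho> s] \<tau>_bounds[of \<rho>' s] \<tau>'_bound[of s \<rho>]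
      by (intro add_mono mult_mono \<tau>'_bound) auto
    finally show ?thesis by simp
  qed

  \<comment> \<open>The truncated power |x|^(-c) and its gradient\<close>
  define f where "f s = s powr (- c / 2) * \<eta> s" for s
  have f: "smooth1 f"
    unfolding f_def
  proof (rule smooth1.powr)
    show "smooth1 \<eta>"
      unfolding \<eta>_def by (intro smooth1.mult smooth1.add smooth1.const \<tau>)
    show "\<rho>\<^sup>2 > 0" using \<rho> by simp
  qed (rule \<eta>_low)
  then obtain f' where f': "\<And>s. (f has_real_derivative f' s) (at s)"
    using smooth1_has_real_derivative by blast
  define u where "u x = f (x \<bullet> x)" for x :: "real ^ 'n"
  have u: "u \<in> C0_infinity"
    unfolding u_def by (rule radial_in_C0_infinity[OF f, of "(2 * \<rho>')\<^sup>2"]) (simp add: f_def \<eta>_out)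
  \<comment> \<open>The squared gradient divided by |x|^(-2c-2), as a function of s = |x|^2. It
    equals \<open>c\<^sup>2\<close> on the plateau, where the cutoff is constant.\<close>
  define e where "e s = (- c * \<eta> s + 2 * (s * \<eta>' s))\<^sup>2" for s
  have u_sq: "(u x)\<^sup>2 = norm x powr (- 2 * c) * (\<eta> (x \<bullet> x))\<^sup>2" if "x \<noteq> 0" for x
  proof -
    have "(x \<bullet> x) powr (- c / 2) = norm x powr (- c)"
      using that by (simp add: dot_square_norm powr_powr flip: powr_numeral)
    moreover have "(norm x powr (- c))\<^sup>2 = norm x powr (- 2 * c)"
      using that by (simp add: powr_powr mult.commute flip: powr_numeral)
    ultimately show ?thesis by (simp add: u_def f_def power_mult_distrib)
  qed
  have grad_sq: "(norm (grad u x))\<^sup>2 = norm x powr (- 2 * c - 2) * e (x \<bullet> x)" if "x \<noteq> 0" for x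
  proof -
    define r where "r = norm x"
    have r: "r > 0" using that by (simp add: r_def)
    have s: "x \<bullet> x = r\<^sup>2" by (simp add: r_def dot_square_norm)
    have "(f has_real_derivative (- c / 2) * r\<^sup>2 powr (- c / 2 - 1) * \<eta> (r\<^sup>2) + r\<^sup>2 powr (- c / 2) * \<eta>' (r\<^sup>2)) (at (r\<^sup>2))"
      unfolding f_def[abs_def] using r by (auto intro!: derivative_eq_intros D\<eta>)
    from DERIV_unique[OF f' this]
    have "f' (r\<^sup>2) = (- c / 2) * r\<^sup>2 powr (- c / 2 - 1) * \<eta> (r\<^sup>2) + r\<^sup>2 powr (- c / 2) * \<eta>' (r\<^sup>2)" .
    also have "\<dots> = r\<^sup>2 powr (- c / 2 - 1) * ((- c / 2) * \<eta> (r\<^sup>2) + r\<^sup>2 * \<eta>' (r\<^sup>2))"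
    proof -
      have shift: "r\<^sup>2 powr (- c / 2) = r\<^sup>2 powr (- c / 2 - 1) * r\<^sup>2"
        using r by (simp add: powr_diff)
      show ?thesis unfolding shift by (simp add: algebra_simps)
    qed
    also have "r\<^sup>2 powr (- c / 2 - 1) = r powr (- c - 2)"
    proof -
      have "r\<^sup>2 powr (- c / 2 - 1) = r powr (2 * (- c / 2 - 1))"
        using r by (simp only: powr_powr flip: powr_numeral)
      also have "2 * (- c / 2 - 1) = - c - 2" by simp
      finally show ?thesis .
    qed
    finally have "f' (r\<^sup>2) = r powr (- c - 2) * ((- c / 2) * \<eta> (r\<^sup>2) + r\<^sup>2 * \<eta>' (r\<^sup>2))" .
    then have f'_eq: "2 * f' (r\<^sup>2) * r = r powr (- c - 2) * r * (- c * \<eta> (r\<^sup>2) + 2 * (r\<^sup>2 * \<eta>' (r\<^sup>2)))"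
      by (simp only:) (simp add: algebra_simps)
    have "norm (grad u x) = \<bar>2 * f' (r\<^sup>2) * r\<bar>"
      unfolding u_def using grad_radial[OF f', of x] r
      by (simp add: s abs_mult) (simp add: r_def)
    then have "(norm (grad u x))\<^sup>2 = (2 * f' (r\<^sup>2) * r)\<^sup>2" by simp
    also have "\<dots> = (r powr (- c - 2) * r)\<^sup>2 * e (r\<^sup>2)"
      unfolding f'_eq by (simp add: e_def power_mult_distrib)
    also have "r powr (- c - 2) * r = r powr (- c - 1)"
      using r by (simp add: powr_diff power2_eq_square)
    also have "(r powr (- c - 1))\<^sup>2 = r powr (- 2 * c - 2)"
      using r by (simp add: powr_powr algebra_simps flip: powr_numeral)
    finally show ?thesis by (simp add: s r_def)
  qed
  have grad_0: "grad u 0 = 0"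
    unfolding u_def using grad_radial[OF f', of "0 :: real ^ 'n"] by simp
  have e_bound: "e s \<le> M" for s
  proof -
    have "\<bar>- c * \<eta> s + 2 * (s * \<eta>' s)\<bar> \<le> \<bar>c\<bar> * \<bar>\<eta> s\<bar> + 2 * \<bar>s * \<eta>' s\<bar>"
      using abs_triangle_ineq[of "- c * \<eta> s" "2 * (s * \<eta>' s)"] by (simp add: abs_mult)
    also have "\<dots> \<le> \<bar>c\<bar> * 1 + 2 * (2 * L)"
      using \<eta>_bounds[of s] by (intro add_mono mult_left_mono \<eta>'_bound) auto
    finally show ?thesis
      unfolding e_def M_def by (intro abs_le_square_iff[THEN iffD1]) auto
  qed

  \<comment> \<open>Comparison of both integrals with the invariant measure\<close>
  have M: "M \<ge> 0" by (simp add: M_def)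
  define J where "J = annulus_measure TYPE('n) 1 2"
  define h where "h x = ennreal (norm x powr (- real CARD('n)))" for x :: "real ^ 'n"
  have h_measurable [measurable]: "h \<in> borel_measurable borel" unfolding h_def by measurable
  have J_shell: "annulus_measure TYPE('n) p (2 * p) = J" if "p > 0" for p
    using annulus_measure_scale[OF that, of 1 2] by (simp add: J_def mult.commute)
  have J_mid: "annulus_measure TYPE('n) (2 * \<rho>) \<rho>' = of_nat N * J"
    using annulus_measure_dyadic[of "2 * \<rho>" N] \<rho> by (simp add: J_def \<rho>'_def mult_ac)
  let ?ann = "\<lambda>p q. indicator {x :: real ^ 'n. p \<le> norm x \<and> norm x < q} :: _ \<Rightarrow> ennreal"
  have s_less: "x \<bullet> x < p\<^sup>2 \<longleftrightarrow> norm x < p" if "p > 0" for x :: "real ^ 'n" and p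
    using that power2_less_imp_less[of "norm x" p]
    by (auto simp: dot_square_norm intro: power_strict_mono)
  \<comment> \<open>The powers 2c - n + 2 of the weight and -2c - 2 of the squared gradient add up
    to -n, which leaves the invariant density. The factor \<open>e\<close> is at most
    \<open>M\<close> on the two cutoff shells and at most \<open>c\<^sup>2\<close> in
    between.\<close>
  have upper: "ennreal (V x * (norm (grad u x))\<^sup>2) \<le>
      ennreal (\<delta> * K) * (ennreal M * (h x * ?ann \<rho> (2 * \<rho>) x) + ennreal (c\<^sup>2) * (h x * ?ann (2 * \<rho>) \<rho>' x) +
        ennreal M * (h x * ?ann \<rho>' (2 * \<rho>') x))" for x
  proof (cases "\<rho> \<le> norm x \<and> norm x < 2 * \<rho>'")
    case False
    then have "e (x \<bullet> x) = 0"
      using \<eta>_out[of "x \<bullet> x"] s_less[OF \<rho>, of x] s_less[of "2 * \<rho>'" x] \<rho>'(1) by (auto simp: e_def)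
    then have "(norm (grad u x))\<^sup>2 = 0" using grad_sq[of x] grad_0 by (cases "x = 0") auto
    then show ?thesis by simp
  next
    case True
    then have x: "x \<noteq> 0" using \<rho> by auto
    have bound: "ennreal (V x * (norm (grad u x))\<^sup>2) \<le> ennreal (\<delta> * K) * (ennreal k * h x)"
      if "e (x \<bullet> x) \<le> k" for k
    proof -
      have e0: "0 \<le> e (x \<bullet> x)" by (simp add: e_def)
      have "V x * (norm (grad u x))\<^sup>2 \<le>
          \<delta> * K * norm x powr (2 * c - real CARD('n) + 2) * (norm x powr (- 2 * c - 2) * e (x \<bullet> x))"
        using VW[of x] True \<rho>'(4) e0 by (simp add: grad_sq[OF x] mult_right_mono)
      also have "\<dots> = \<delta> * K * e (x \<bullet> x) *
          (norm x powr (2 * c - real CARD('n) + 2) * norm x powr (- 2 * c - 2))"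
        by simp
      also have "\<dots> = \<delta> * K * (e (x \<bullet> x) * norm x powr (- real CARD('n)))"
        by (simp flip: powr_add)
      also have "\<dots> \<le> \<delta> * K * (k * norm x powr (- real CARD('n)))"
        using \<delta> K that by (intro mult_left_mono mult_right_mono) auto
      finally show ?thesis
        using \<delta> K e0 that by (simp add: h_def ennreal_leI flip: ennreal_mult)
    qed
    consider "norm x < 2 * \<rho>" | "2 * \<rho> \<le> norm x" "norm x < \<rho>'" | "\<rho>' \<le> norm x"
      by linarith
    then show ?thesis
    proof cases
      case 1
      then show ?thesis using bound[OF e_bound] True \<rho>'(3) by simp
    next
      case 2
      then have "e (x \<bullet> x) \<le> c\<^sup>2"
        using \<eta>_mid[of "x \<bullet> x"] s_less[of "2 * \<rho>" x] s_less[of \<rho>' x] \<rho> \<rho>'(1) by (auto simp: e_def)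
      from bound[OF this] 2 show ?thesis by simp
    next
      case 3
      then show ?thesis using bound[OF e_bound] True \<rho>'(3) by simp
    qed
  qed
  \<comment> \<open>Only the plateau is kept. There the powers 2c - n and -2c again combine to
    -n.\<close>
  have lower: "ennreal K * (h x * ?ann (2 * \<rho>) \<rho>' x) \<le> ennreal (W x * (u x)\<^sup>2)" for x
  proof (cases "2 * \<rho> \<le> norm x \<and> norm x < \<rho>'")
    case True
    then have x: "x \<noteq> 0" using \<rho> by auto
    have "\<eta> (x \<bullet> x) = 1"
      using True \<eta>_mid[of "x \<bullet> x"] s_less[of "2 * \<rho>" x] s_less[of \<rho>' x] \<rho> \<rho>'(1) by auto
    then have "(u x)\<^sup>2 = norm x powr (- 2 * c)" by (simp add: u_sq[OF x])
    moreover have "K * norm x powr (2 * c - real CARD('n)) \<le> W x"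
      using VW[of x] True \<rho> \<rho>' by simp
    ultimately have "K * norm x powr (2 * c - real CARD('n)) * norm x powr (- 2 * c) \<le> W x * (u x)\<^sup>2"
      by (simp add: mult_right_mono)
    then have "K * norm x powr (- real CARD('n)) \<le> W x * (u x)\<^sup>2"
      by (simp add: mult.assoc flip: powr_add)
    then show ?thesis using True K by (simp add: h_def ennreal_leI flip: ennreal_mult')
  qed simp
  have "ennreal C * (ennreal K * (of_nat N * J)) =
      ennreal C * (\<integral>\<^sup>+ x. ennreal K * (h x * ?ann (2 * \<rho>) \<rho>' x) \<partial>lborel)"
    by (subst nn_integral_cmult) (simp_all add: J_mid[symmetric] annulus_measure_def h_def)
  also have "\<dots> \<le> ennreal C * (\<integral>\<^sup>+ x. ennreal (W x * (u x)\<^sup>2) \<partial>lborel)"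
    by (intro mult_left_mono nn_integral_mono lower) simp
  also have "\<dots> \<le> (\<integral>\<^sup>+ x. ennreal (V x * (norm (grad u x))\<^sup>2) \<partial>lborel)"
    using hardy u by (auto simp: hardy_inequality_def)
  also have "\<dots> \<le> (\<integral>\<^sup>+ x. ennreal (\<delta> * K) * (ennreal M * (h x * ?ann \<rho> (2 * \<rho>) x) +
      ennreal (c\<^sup>2) * (h x * ?ann (2 * \<rho>) \<rho>' x) + ennreal M * (h x * ?ann \<rho>' (2 * \<rho>') x)) \<partial>lborel)"
    by (intro nn_integral_mono upper)
  also have "\<dots> = ennreal (\<delta> * K) * (ennreal M * annulus_measure TYPE('n) \<rho> (2 * \<rho>) +
      ennreal (c\<^sup>2) * annulus_measure TYPE('n) (2 * \<rho>) \<rho>' + ennreal M * annulus_measure TYPE('n) \<rho>' (2 * \<rho>'))"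
    by (simp add: nn_integral_add nn_integral_cmult annulus_measure_def h_def[symmetric])
  also have "\<dots> = ennreal (\<delta> * K) * (ennreal M * J + ennreal (c\<^sup>2) * (of_nat N * J) + ennreal M * J)"
    by (simp only: J_shell[OF \<rho>] J_shell[OF \<rho>'(1)] J_mid)
  finally have le: "ennreal C * (ennreal K * (of_nat N * J)) \<le> \<dots>" .
  \<comment> \<open>Since \<open>J\<close> is finite and positive, the estimate becomes one between
    reals, and cancelling \<open>K * j\<close> contradicts the choice of \<open>N\<close>.\<close>
  obtain j where j: "J = ennreal j" "j > 0"
    using annulus_measure_finite[where 'n = 'n] annulus_measure_pos[where 'n = 'n]
    by (cases J) (auto simp: J_def)
  have C0: "C > 0" using C by (smt (verit) zero_le_power2)
  from le have "C * (K * (real N * j)) \<le> \<delta> * K * (M * j + c\<^sup>2 * (real N * j) + M * j)"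
    using j \<delta> K M C0
    by (simp add: ennreal_of_nat_eq_real_of_nat ennreal_plus[symmetric] ennreal_mult'[symmetric] del: ennreal_plus)
  then have "(C * real N) * (K * j) \<le> (\<delta> * (2 * M + c\<^sup>2 * real N)) * (K * j)"
    by (simp add: algebra_simps)
  then show False
    using N K j by (simp add: mult_le_cancel_right)
qed

section \<open>Power asymptotics of the weights at 0 and at infinity\<close>

lemma powr_tendsto_zero:
  fixes s :: real
  shows "(F = at_top \<and> s < 0) \<or> (F = at_right 0 \<and> s > 0) \<Longrightarrow> ((\<lambda>r. r powr s) \<longlongrightarrow> 0) F"
  by (elim disjE conjE; hypsubst; real_asymp)

text \<open>A neighbourhood of 0 or of infinity contains annuli of any prescribed ratio of radii, so
  the eventual bounds given by the limit hold on a whole annulus.\<close>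

lemma almost_constant_on_annulus:
  fixes h :: "real \<Rightarrow> real"
  assumes lim: "(h \<longlongrightarrow> H) F" and F: "F = at_top \<or> F = at_right 0" and H: "H > 0" and \<delta>: "\<delta> > 1"
  shows "\<exists>\<rho>>0. \<exists>K>0. \<forall>r. \<rho> \<le> r \<and> r \<le> \<rho> * 2 ^ N \<longrightarrow> K \<le> h r \<and> h r \<le> \<delta> * K"
proof -
  \<comment> \<open>Chosen so that H lies strictly between \<open>K\<close> and
    \<open>\<delta> * K\<close>.\<close>
  define K where "K = H * (2 / (1 + \<delta>))"
  have K: "K > 0" "K < H" "H < \<delta> * K"
    using H \<delta> by (simp_all add: K_def field_simps)
  have ev: "\<forall>\<^sub>F r in F. K \<le> h r \<and> h r \<le> \<delta> * K"
    using order_tendstoD(1)[OF lim K(2)] order_tendstoD(2)[OF lim K(3)] by eventually_elim simp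
  from F have "\<exists>\<rho>>0. \<forall>r. \<rho> \<le> r \<and> r \<le> \<rho> * 2 ^ N \<longrightarrow> K \<le> h r \<and> h r \<le> \<delta> * K"
  proof
    assume "F = at_top"
    with ev obtain R where R: "\<And>r. r \<ge> R \<Longrightarrow> K \<le> h r \<and> h r \<le> \<delta> * K"
      by (auto simp: eventually_at_top_linorder)
    show ?thesis
      by (intro exI[of _ "max 1 R"]) (auto intro!: R)
  next
    assume "F = at_right 0"
    with ev have "\<exists>R>0. \<forall>r>0. r < R \<longrightarrow> K \<le> h r \<and> h r \<le> \<delta> * K"
      by (simp add: eventually_at_right_field)
    then obtain R where R: "R > 0" "\<And>r. r > 0 \<Longrightarrow> r < R \<Longrightarrow> K \<le> h r \<and> h r \<le> \<delta> * K"
      by blast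
    \<comment> \<open>The extra factor 2 puts the outer radius at R/2, strictly inside the range of
      the bounds.\<close>
    define \<rho> where "\<rho> = R / (2 * 2 ^ N)"
    have \<rho>: "\<rho> > 0" "\<rho> * 2 ^ N < R" using R(1) by (simp_all add: \<rho>_def)
    have "K \<le> h r \<and> h r \<le> \<delta> * K" if "\<rho> \<le> r \<and> r \<le> \<rho> * 2 ^ N" for r
      using that \<rho> by (intro R(2)) linarith+
    then show ?thesis using \<rho>(1) by blast
  qed
  then show ?thesis using K(1) by blast
qed

text \<open>The filter \<open>F\<close> selects the end, 0 or infinity, at which (a + b
  r^\<alpha>)^\<beta> is asymptotic to H r^\<gamma>. There the weights behave like H |x|^(\<gamma> -
  2m) and H |x|^(\<gamma> - 2m - 2).\<close>

lemma best_constant_weight: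
  fixes a b \<alpha> \<beta> m c \<gamma> H :: real
  assumes c: "2 * c = real CARD('n) - 2 * m - 2 + \<gamma>"
    and lim: "((\<lambda>r. (a + b * r powr \<alpha>) powr \<beta> * r powr (- \<gamma>)) \<longlongrightarrow> H) F"
    and F: "F = at_top \<or> F = at_right 0" and H: "H > 0"
  shows "best_constant (hardy_inequality (weight a b \<alpha> \<beta> (2 * m)) (weight a b \<alpha> \<beta> (2 * m + 2) :: real ^ 'n \<Rightarrow> real))
    (c\<^sup>2)"
  unfolding best_constant_def
proof (intro allI impI notI)
  let ?V = "weight a b \<alpha> \<beta> (2 * m) :: real ^ 'n \<Rightarrow> real"
  let ?W = "weight a b \<alpha> \<beta> (2 * m + 2) :: real ^ 'n \<Rightarrow> real"
  let ?h = "\<lambda>r. (a + b * r powr \<alpha>) powr \<beta> * r powr (- \<gamma>)"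
  fix C assume "c\<^sup>2 < C" and hardy: "hardy_inequality ?V ?W C"
  have "C \<le> c\<^sup>2"
  proof (rule hardy_constant_le[OF hardy])
    fix \<delta> :: real and N :: nat assume "\<delta> > 1"
    from almost_constant_on_annulus[OF lim F H this, of N]
    obtain \<rho> K where \<rho>: "\<rho> > 0" and K: "K > 0"
      and h: "\<And>r. \<rho> \<le> r \<Longrightarrow> r \<le> \<rho> * 2 ^ N \<Longrightarrow> K \<le> ?h r \<and> ?h r \<le> \<delta> * K" by blast
    have weight_eq: "weight a b \<alpha> \<beta> s x = ?h (norm x) * norm x powr (\<gamma> - s)" if "x \<noteq> 0" for s and x :: "real ^ 'n"
      using that by (simp add: weight_def powr_diff powr_minus field_simps)
    have exps: "2 * c - real CARD('n) = \<gamma> - (2 * m + 2)" "2 * c - real CARD('n) + 2 = \<gamma> - 2 * m"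
      using c by simp_all
    have "K * norm x powr (2 * c - real CARD('n)) \<le> ?W x \<and>
        ?V x \<le> \<delta> * K * norm x powr (2 * c - real CARD('n) + 2)"
      if "\<rho> \<le> norm x" "norm x \<le> \<rho> * 2 ^ N" for x
    proof -
      have x: "x \<noteq> 0" using that \<rho> by auto
      show ?thesis
        unfolding exps weight_eq[OF x] using h[OF that] by (auto intro!: mult_right_mono)
    qed
    with \<rho> K show "\<exists>\<rho>>0. \<exists>K>0. \<forall>x. \<rho> \<le> norm x \<and> norm x \<le> \<rho> * 2 ^ N \<longrightarrow>
        K * norm x powr (2 * c - real CARD('n)) \<le> ?W x \<and>
        ?V x \<le> \<delta> * K * norm x powr (2 * c - real CARD('n) + 2)"
      by blast
  qed
  with \<open>c\<^sup>2 < C\<close> show False by simp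
qed

text \<open>In case (ii) this reduces the monotonicity to comparing \<open>a\<close> with
  \<open>a * l powr (- \<alpha>)\<close>. With \<open>l = r\<close> it exhibits the limit, since the
  base becomes a r^(-\<alpha>) + b.\<close>

lemma powr_add_powr_factor:
  fixes a b \<alpha> \<beta> l r :: real
  assumes "a > 0" "b > 0" "l > 0" "r > 0"
  shows "l powr (- (\<alpha> * \<beta>)) * (a + b * r powr \<alpha>) powr \<beta> =
    (a * l powr (- \<alpha>) + b * (r / l) powr \<alpha>) powr \<beta>"
proof -
  have "a * l powr (- \<alpha>) + b * (r / l) powr \<alpha> = l powr (- \<alpha>) * (a + b * r powr \<alpha>)"
    using assms by (simp add: powr_divide powr_minus field_simps)
  moreover have "(l powr (- \<alpha>) * (a + b * r powr \<alpha>)) powr \<beta> =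
      (l powr (- \<alpha>)) powr \<beta> * (a + b * r powr \<alpha>) powr \<beta>"
    by (rule powr_mult)
  ultimately show ?thesis using assms by (simp add: powr_powr)
qed

theorem theorem2p12:
  fixes a b \<alpha> \<beta> m n :: real
    and V W :: "real ^ 'n \<Rightarrow> real"
  assumes "a > 0" and "b > 0"
  defines "n \<equiv> real CARD('n)"
    and "V \<equiv> weight a b \<alpha> \<beta> (2 * m)"
    and "W \<equiv> weight a b \<alpha> \<beta> (2 * m + 2)"
  shows "(\<alpha> * \<beta> > 0 \<and> m \<le> (n - 2) / 2 \<longrightarrow>
            hardy_inequality V W (((n - 2 * m - 2) / 2)\<^sup>2) \<and>
            best_constant (hardy_inequality V W) (((n - 2 * m - 2) / 2)\<^sup>2))
       \<and> (\<alpha> * \<beta> < 0 \<and> 2 * m - \<alpha> * \<beta> \<le> n - 2 \<longrightarrow>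
            hardy_inequality V W (((n - 2 * m + \<alpha> * \<beta> - 2) / 2)\<^sup>2) \<and>
            best_constant (hardy_inequality V W) (((n - 2 * m + \<alpha> * \<beta> - 2) / 2)\<^sup>2))"
proof (intro conjI impI; elim conjE)
  assume sgn: "\<alpha> * \<beta> > 0" and m: "m \<le> (n - 2) / 2"
  then have signs: "\<alpha> > 0 \<and> \<beta> > 0 \<or> \<alpha> < 0 \<and> \<beta> < 0" by (simp add: zero_less_mult_iff)
  show "hardy_inequality V W (((n - 2 * m - 2) / 2)\<^sup>2)"
    unfolding V_def W_def
  proof (rule hardy_inequality_weight[where \<gamma> = 0])
    fix l r :: real assume l: "l \<ge> 1" and r: "r > 0"
    have rl: "r / l \<le> r" "r / l > 0" using l r by (simp_all add: field_simps)
    \<comment> \<open>The base moves with the sign of \<open>\<alpha>\<close> and the outer power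
      with the sign of \<open>\<beta>\<close>; equal signs make the composition nondecreasing in
      r.\<close>
    from signs have "(a + b * (r / l) powr \<alpha>) powr \<beta> \<le> (a + b * r powr \<alpha>) powr \<beta>"
    proof
      assume "\<alpha> > 0 \<and> \<beta> > 0"
      then show ?thesis
        using assms(1,2) rl by (intro powr_mono2 add_left_mono mult_left_mono) auto
    next
      assume "\<alpha> < 0 \<and> \<beta> < 0"
      then show ?thesis
        using assms(1,2) r rl by (intro powr_mono2' add_left_mono mult_left_mono) (auto intro: add_pos_pos)
    qed
    then show "(a + b * (r / l) powr \<alpha>) powr \<beta> \<le> l powr (- 0) * (a + b * r powr \<alpha>) powr \<beta>"
      using l by simp
  qed (use m in \<open>simp_all add: n_def\<close>)
  show "best_constant (hardy_inequality V W) (((n - 2 * m - 2) / 2)\<^sup>2)"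
    unfolding V_def W_def
  \<comment> \<open>The end is the one at which r^\<alpha> tends to 0, so that the factor tends to
    a^\<beta> > 0.\<close>
  proof (rule best_constant_weight[where \<gamma> = 0 and H = "(a + b * 0) powr \<beta>"
        and F = "if \<alpha> > 0 then at_right 0 else at_top"])
    let ?F = "if \<alpha> > 0 then at_right 0 else at_top :: real filter"
    have "((\<lambda>r. (a + b * r powr \<alpha>) powr \<beta>) \<longlongrightarrow> (a + b * 0) powr \<beta>) ?F"
      using assms(1) signs by (intro tendsto_intros powr_tendsto_zero) auto
    \<comment> \<open>\<open>r powr (- 0)\<close> is 1 for r > 0 but 0 at r = 0, so the two
      functions are compared eventually along the filter.\<close>
    moreover have "\<forall>\<^sub>F r in ?F. r > 0"
      by (simp add: eventually_gt_at_top eventually_at_right_less)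
    then have "\<forall>\<^sub>F r in ?F. (a + b * r powr \<alpha>) powr \<beta> = (a + b * r powr \<alpha>) powr \<beta> * r powr (- 0)"
      by (rule eventually_mono) simp
    ultimately show "((\<lambda>r. (a + b * r powr \<alpha>) powr \<beta> * r powr (- 0)) \<longlongrightarrow> (a + b * 0) powr \<beta>) ?F"
      by (rule Lim_transform_eventually)
  qed (use assms(1) in \<open>simp_all add: n_def\<close>)
next
  assume sgn: "\<alpha> * \<beta> < 0" and m: "2 * m - \<alpha> * \<beta> \<le> n - 2"
  then have signs: "\<alpha> > 0 \<and> \<beta> < 0 \<or> \<alpha> < 0 \<and> \<beta> > 0" by (simp add: mult_less_0_iff)
  show "hardy_inequality V W (((n - 2 * m + \<alpha> * \<beta> - 2) / 2)\<^sup>2)"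
    unfolding V_def W_def
  proof (rule hardy_inequality_weight[where \<gamma> = "\<alpha> * \<beta>"])
    fix l r :: real assume l: "l \<ge> 1" and r: "r > 0"
    \<comment> \<open>As l \<ge> 1, the factor l^(-\<alpha>) lowers the base when \<alpha> > 0 and
      raises it when \<alpha> < 0; the opposite sign of \<open>\<beta>\<close> turns both into the
      same inequality.\<close>
    from signs have "(a + b * (r / l) powr \<alpha>) powr \<beta> \<le> (a * l powr (- \<alpha>) + b * (r / l) powr \<alpha>) powr \<beta>"
    proof
      assume s: "\<alpha> > 0 \<and> \<beta> < 0"
      then have "l powr (- \<alpha>) \<le> l powr 0" using l by (intro powr_mono) auto
      then show ?thesis
        using assms(1,2) r l s by (intro powr_mono2' add_right_mono) (auto intro: add_pos_pos)
    next
      assume s: "\<alpha> < 0 \<and> \<beta> > 0"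
      then have "l powr 0 \<le> l powr (- \<alpha>)" using l by (intro powr_mono) auto
      then show ?thesis
        using assms(1,2) r l s by (intro powr_mono2 add_right_mono) auto
    qed
    then show "(a + b * (r / l) powr \<alpha>) powr \<beta> \<le> l powr (- (\<alpha> * \<beta>)) * (a + b * r powr \<alpha>) powr \<beta>"
      using l r assms(1,2) by (simp only: powr_add_powr_factor)
  qed (use m in \<open>simp_all add: n_def\<close>)
  show "best_constant (hardy_inequality V W) (((n - 2 * m + \<alpha> * \<beta> - 2) / 2)\<^sup>2)"
    unfolding V_def W_def
  \<comment> \<open>The opposite end to case (i): here r^(-\<alpha>) tends to 0 and the normalised
    factor tends to b^\<beta> > 0.\<close>
  proof (rule best_constant_weight[where \<gamma> = "\<alpha> * \<beta>" and H = "(a * 0 + b) powr \<beta>"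
        and F = "if \<alpha> > 0 then at_top else at_right 0"])
    let ?F = "if \<alpha> > 0 then at_top else at_right 0 :: real filter"
    have "((\<lambda>r. (a * r powr (- \<alpha>) + b) powr \<beta>) \<longlongrightarrow> (a * 0 + b) powr \<beta>) ?F"
      using assms(2) signs by (intro tendsto_intros powr_tendsto_zero) auto
    moreover have "\<forall>\<^sub>F r in ?F. r > 0"
      by (simp add: eventually_gt_at_top eventually_at_right_less)
    then have "\<forall>\<^sub>F r in ?F. (a * r powr (- \<alpha>) + b) powr \<beta> =
        (a + b * r powr \<alpha>) powr \<beta> * r powr (- (\<alpha> * \<beta>))"
      by (rule eventually_mono)
        (use powr_add_powr_factor[OF assms(1,2), of r r \<alpha> \<beta> for r] in \<open>simp add: mult.commute\<close>)
    ultimately show "((\<lambda>r. (a + b * r powr \<alpha>) powr \<beta> * r powr (- (\<alpha> * \<beta>))) \<longlongrightarrow> (a * 0 + b) powr \<beta>) ?F"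
      by (rule Lim_transform_eventually)
  qed (use assms(2) in \<open>simp_all add: n_def\<close>)
qed

end
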